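(* Let $\mathcal{E}$ be the set of irrational $\alpha\in\mathbb{T}$ such that $$\sum_{i\notin K_\alpha,\ i\ge1}\frac{1}{\log^{7/8}q_i}<+\infty,\qquad K_\alpha:=\{n\in\mathbb{N}: q_{n+1}<q_n\log^{7/8}(q_n)\},$$ where $(q_n)$ is the sequence of denominators of the best rational approximations of $\alpha$. Then $\lambda(\mathcal{E})=1$.
   Context: $\mathbb{T}=\mathbb{R}/\mathbb{Z}$ and $\lambda$ is the Haar (Lebesgue) probability measure on $\mathbb{T}$. $\|\cdot\|$ is the distance to the nearest integer. For irrational $\alpha$, $(q_s)_{s\ge0}$ is the unique increasing sequence of integers with $q_0=1$ and $\|q_s\alpha\|<\|k\alpha\|$ for every $1\le k<q_{s+1}$, $k\ne q_s$. *)

theory Defs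
  imports "HOL-Analysis.Analysis"
begin

text \<open>
  The circle \<open>\<real>/\<int>\<close> is represented by the fundamental domain \<open>{0..<1}\<close>; under this identification
  its Haar probability measure is Lebesgue measure on \<open>{0..<1}\<close>. The other notions below
  only depend on the class of \<open>\<alpha>\<close> modulo 1 (see \<open>best_denoms_add_int\<close>).
\<close>

definition circle_measure :: "real measure" where
  "circle_measure = lebesgue_on {0..<1}"

lemma emeasure_circle_measure_space: "emeasure circle_measure (space circle_measure) = 1"
  by (simp add: circle_measure_def emeasure_restrict_space)

definition nint_dist :: "real \<Rightarrow> real" where
  "nint_dist x = \<bar>x - of_int (round x)\<bar>"

text \<open>
  \<open>q\<close> is required to be strictly increasing. In particular \<open>q 1 \<ge> 2\<close>, so that for
  \<open>\<alpha> \<in> {1/2<..<1}\<close> the sequence is that of the continued fraction denominators with the repeated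
  initial 1 listed only once.
\<close>

definition is_best_denoms :: "real \<Rightarrow> (nat \<Rightarrow> nat) \<Rightarrow> bool" where
  "is_best_denoms \<alpha> q \<longleftrightarrow> strict_mono q \<and> q 0 = 1 \<and>
     (\<forall>s k. 1 \<le> k \<and> k < q (s + 1) \<and> k \<noteq> q s \<longrightarrow>
        nint_dist (real (q s) * \<alpha>) < nint_dist (real k * \<alpha>))"

text \<open>Only meaningful for irrational \<open>\<alpha>\<close>, see \<open>ex1_best_denoms\<close>.\<close>

definition best_denoms :: "real \<Rightarrow> nat \<Rightarrow> nat" where
  "best_denoms \<alpha> = (THE q. is_best_denoms \<alpha> q)"

definition K_set :: "real \<Rightarrow> nat set" where
  "K_set \<alpha> = {n. real (best_denoms \<alpha> (n + 1))
                  < real (best_denoms \<alpha> n) * ln (real (best_denoms \<alpha> n)) powr (7/8)}"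

definition E_set :: "real set" where
  "E_set = {\<alpha> \<in> {0..<1}. \<alpha> \<notin> \<rat> \<and>
     (\<lambda>i. 1 / ln (real (best_denoms \<alpha> i)) powr (7/8)) summable_on {i. i \<notin> K_set \<alpha> \<and> i \<ge> 1}}"

lemma nint_dist_le: "nint_dist x \<le> \<bar>x - of_int m\<bar>"
  by (simp add: nint_dist_def round_diff_minimal)

lemma nint_dist_add_int: "nint_dist (x + of_int m) = nint_dist x"
proof -
  have "x + of_int m + 1 / 2 = (x + 1 / 2) + of_int m" by simp
  then have "round (x + of_int m) = round x + m"
    unfolding round_def by (metis floor_add_int)
  then show ?thesis by (simp add: nint_dist_def)
qed

lemma best_denoms_add_int: "best_denoms (\<alpha> + of_int m) = best_denoms \<alpha>"
proof -
  have "nint_dist (real k * (\<alpha> + of_int m)) = nint_dist (real k * \<alpha>)" for k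
    using nint_dist_add_int[of "real k * \<alpha>" "int k * m"] by (simp add: algebra_simps)
  then show ?thesis
    by (simp add: best_denoms_def is_best_denoms_def)
qed

lemma irrational_mult_not_int:
  assumes "\<alpha> \<notin> \<rat>" and "c \<noteq> 0" shows "of_int c * \<alpha> \<noteq> of_int m"
proof
  assume "of_int c * \<alpha> = of_int m"
  then have "\<alpha> = of_int m / of_int c"
    using assms(2) by (simp add: field_simps)
  with assms(1) show False by simp
qed

lemma nint_dist_inj:
  assumes "\<alpha> \<notin> \<rat>" and "k \<ge> 1" and "nint_dist (real k * \<alpha>) = nint_dist (real j * \<alpha>)"
  shows "k = j"
proof (rule ccontr)
  assume "k \<noteq> j"
  define a b where "a = round (real k * \<alpha>)" and "b = round (real j * \<alpha>)"
  have "real k * \<alpha> - a = real j * \<alpha> - b \<or> real k * \<alpha> - a = - (real j * \<alpha> - b)"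
    using assms(3) unfolding nint_dist_def a_def b_def by linarith
  then show False
  proof
    assume "real k * \<alpha> - a = real j * \<alpha> - b"
    then have "of_int (int k - int j) * \<alpha> = of_int (a - b)"
      by (simp add: algebra_simps)
    moreover have "int k - int j \<noteq> 0"
      using \<open>k \<noteq> j\<close> by simp
    ultimately show False
      using irrational_mult_not_int[OF assms(1)] by blast
  next
    assume "real k * \<alpha> - a = - (real j * \<alpha> - b)"
    then have "of_int (int k + int j) * \<alpha> = of_int (a + b)"
      by (simp add: algebra_simps)
    moreover have "int k + int j \<noteq> 0"
      using \<open>k \<ge> 1\<close> by simp
    ultimately show False
      using irrational_mult_not_int[OF assms(1)] by blast
  qed
qed

lemma nint_dist_pos:
  assumes "\<alpha> \<notin> \<rat>" and "k \<ge> 1" shows "nint_dist (real k * \<alpha>) > 0"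
  using nint_dist_inj[OF assms, of 0] assms(2) by (force simp: nint_dist_def)

lemma ex_better_denom:
  assumes "\<alpha> \<notin> \<rat>" and "n \<ge> 1"
  shows "\<exists>k>n. nint_dist (real k * \<alpha>) < nint_dist (real n * \<alpha>)"
proof -
  define \<delta> where "\<delta> = Min ((\<lambda>j. nint_dist (real j * \<alpha>)) ` {1..n})"
  have "\<delta> > 0"
    using assms by (auto simp: \<delta>_def nint_dist_pos)
  then obtain N :: nat where N: "N > 0" "1 / real N < \<delta>"
    by (metis gr_zeroI inverse_eq_divide real_arch_inverse)
  obtain h k where hk: "0 < k" "k \<le> int N" "\<bar>of_int k * \<alpha> - of_int h\<bar> < 1 / N"
    using Dirichlet_approx[OF N(1)] by blast
  have *: "nint_dist (real (nat k) * \<alpha>) < \<delta>"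
    using nint_dist_le[of "of_int k * \<alpha>" h] hk N by simp
  have \<delta>_le: "\<delta> \<le> nint_dist (real j * \<alpha>)" if "j \<in> {1..n}" for j
    using that by (auto simp: \<delta>_def)
  have "nat k > n"
    using \<delta>_le[of "nat k"] * hk(1) by force
  with * \<delta>_le[of n] assms(2) show ?thesis
    by force
qed

lemma ex1_best_denoms:
  assumes irr: "\<alpha> \<notin> \<rat>"
  shows "\<exists>!q. is_best_denoms \<alpha> q"
proof -
  define d where "d k = nint_dist (real k * \<alpha>)" for k
  define nxt where "nxt n = (LEAST k. k > n \<and> d k < d n)" for n
  have nxt: "nxt n > n \<and> d (nxt n) < d n" if "n \<ge> 1" for n
    unfolding nxt_def by (rule LeastI_ex) (use ex_better_denom[OF irr that] in \<open>simp add: d_def\<close>)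
  have nxt_least: "nxt n \<le> k" if "k > n" "d k < d n" for n k
    unfolding nxt_def using that by (simp add: Least_le)
  have inj: "k = j" if "k \<ge> 1" "d k = d j" for k j
    using nint_dist_inj[OF irr] that by (simp add: d_def)
  show ?thesis
  proof (rule ex_ex1I)
    define q where "q s = (nxt ^^ s) 1" for s
    have q0: "q 0 = 1" and qS: "q (Suc s) = nxt (q s)" for s
      by (simp_all add: q_def)
    have q1: "q s \<ge> 1" for s
    proof (induction s)
      case (Suc s)
      then show ?case using nxt[OF Suc] by (simp add: qS)
    qed (simp add: q0)
    have above: "d (q s) < d k" if "q s < k" "k < q (Suc s)" for s k
      using nxt_least[of "q s" k] inj[of k "q s"] that by (force simp: qS)
    have main: "d (q s) < d k" if "1 \<le> k" "k < q (Suc s)" "k \<noteq> q s" for s k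
      using that
    proof (induction s arbitrary: k)
      case 0
      then show ?case using above[of 0 k] by (simp add: q0)
    next
      case (Suc s)
      have less: "d (q (Suc s)) < d (q s)"
        using nxt[OF q1] by (simp add: qS)
      consider "k > q (Suc s)" | "k < q (Suc s)"
        using Suc.prems by linarith
      then show ?case
      proof cases
        case 1
        then show ?thesis using above Suc.prems by blast
      next
        case 2
        then show ?thesis using Suc.IH[of k] Suc.prems less by (cases "k = q s") auto
      qed
    qed
    have "strict_mono q"
      using nxt[OF q1] by (simp add: strict_mono_Suc_iff qS)
    with main q0 have "is_best_denoms \<alpha> q"
      by (simp add: is_best_denoms_def d_def)
    then show "\<exists>q. is_best_denoms \<alpha> q" by blast
  next
    have rec: "r (Suc s) = nxt (r s)" if "is_best_denoms \<alpha> r" for r s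
    proof -
      have r: "strict_mono r" "r 0 = 1"
        and best: "\<And>s k. 1 \<le> k \<Longrightarrow> k < r (Suc s) \<Longrightarrow> k \<noteq> r s \<Longrightarrow> d (r s) < d k"
        using that by (auto simp: is_best_denoms_def d_def)
      have lt: "r s < r (Suc s)" for s
        using r(1) by (simp add: strict_mono_Suc_iff)
      have r1: "r s \<ge> 1" for s
        using r strict_mono_less_eq[OF r(1), of 0 s] by simp
      have "d (r (Suc s)) < d (r s)"
        using best[of "r s" "Suc s"] r1[of s] lt[of s] lt[of "Suc s"] by simp
      then have "nxt (r s) \<le> r (Suc s)"
        using nxt_least lt by blast
      moreover have "\<not> nxt (r s) < r (Suc s)"
        using best[of "nxt (r s)" s] nxt[OF r1[of s]] r1[of s] by force
      ultimately show ?thesis by simp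
    qed
    fix q r assume q: "is_best_denoms \<alpha> q" and r: "is_best_denoms \<alpha> r"
    show "q = r"
    proof
      fix s show "q s = r s"
      proof (induction s)
        case 0
        then show ?case using q r by (simp add: is_best_denoms_def)
      next
        case (Suc s)
        then show ?case by (simp only: rec[OF q] rec[OF r])
      qed
    qed
  qed
qed

end

theory Submission
  imports Defs
begin

text \<open>
  Write \<open>L(n) = log(n)^(7/8)\<close>. Dirichlet's theorem gives \<open>\<parallel>q_i \<alpha>\<parallel> \<le> 2 / q_{i+1}\<close>
  (\<open>nint_dist_best_denom_less\<close>). If \<open>i \<notin> K\<^sub>\<alpha>\<close>, then \<open>q_{i+1} \<ge> q_i L(q_i)\<close>, so that
  \<open>n = q_i\<close> satisfies \<open>\<parallel>n \<alpha>\<parallel> \<le> 2 / (n L(n))\<close>. Since the \<open>q_i\<close> are distinct, the series in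
  the definition of the set is bounded by the sum of \<open>1 / L(n)\<close> over all integers \<open>n \<ge> 2\<close>,
  denominators or not, that satisfy this inequality (\<open>E_setI\<close>).

  For given \<open>n\<close> the inequality holds on a set of measure \<open>O(1 / (n L(n)))\<close>
  (\<open>emeasure_nint_dist_le\<close>), so the expectation of the larger sum is at most a constant times
  \<open>\<Sum> 1 / (n L(n)^2) = \<Sum> 1 / (n log(n)^(7/4))\<close>. This series converges because \<open>7/4 > 1\<close>
  (\<open>summable_inverse_mult_ln_powr\<close>), and a nonnegative function with finite expectation is finite
  almost everywhere (\<open>AE_summable_weight_nint_dist_le\<close>).
\<close>

text \<open>
  Cauchy condensation compares this series with \<open>\<Sum> n\<^sup>-\<^sup>s\<close>. It is applied to the terms shifted by
  one, because the term at \<open>n = 1\<close> is \<open>1 / 0 = 0\<close> and spoils the monotonicity that the test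
  requires.
\<close>

lemma summable_inverse_mult_ln_powr:
  fixes s :: real
  assumes "s > 1"
  shows "summable (\<lambda>n. 1 / (real n * ln (real n) powr s))"
proof -
  define g where "g n = 1 / (real (Suc n) * ln (real (Suc n)) powr s)" for n
  have g_nonneg: "g n \<ge> 0" for n
    by (simp add: g_def)
  have g_decreasing: "g (Suc m) \<le> g m" if "0 < m" for m
  proof -
    have "real (Suc m) * ln (real (Suc m)) powr s
        \<le> real (Suc (Suc m)) * ln (real (Suc (Suc m))) powr s"
      using assms by (intro mult_mono powr_mono2) auto
    then show ?thesis
      unfolding g_def using that by (intro divide_left_mono mult_pos_pos) auto
  qed
  have condensed: "2 ^ n * g (2 ^ n) \<le> ln 2 powr (- s) * real n powr (- s)" if "n \<ge> 1" for n
  proof -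
    have "real n * ln 2 = ln (2 ^ n)"
      by (simp add: ln_realpow)
    also have "\<dots> \<le> ln (real (Suc (2 ^ n)))"
      by (intro ln_mono) (auto intro: add_pos_pos)
    finally have "(real n * ln 2) powr s \<le> ln (real (Suc (2 ^ n))) powr s"
      using assms by (intro powr_mono2) auto
    then have "2 ^ n * (real n * ln 2) powr s
        \<le> real (Suc (2 ^ n)) * ln (real (Suc (2 ^ n))) powr s"
      by (intro mult_mono) auto
    then have "g (2 ^ n) \<le> 1 / (2 ^ n * (real n * ln 2) powr s)"
      unfolding g_def using that by (intro frac_le) auto
    then have "2 ^ n * g (2 ^ n) \<le> 2 ^ n * (1 / (2 ^ n * (real n * ln 2) powr s))"
      by (intro mult_left_mono) auto
    also have "\<dots> = ln 2 powr (- s) * real n powr (- s)"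
      using that by (simp add: powr_mult powr_minus field_simps)
    finally show ?thesis .
  qed
  have "summable (\<lambda>n. ln 2 powr (- s) * real n powr (- s))"
    using assms by (intro summable_mult) (simp add: summable_real_powr_iff)
  then have "summable (\<lambda>n. 2 ^ n * g (2 ^ n))"
    by (rule summable_comparison_test'[where N = 1]) (simp add: condensed g_nonneg)
  then have "summable g"
    using condensation_test[of g] g_decreasing g_nonneg by blast
  then show ?thesis
    unfolding g_def by (subst summable_Suc_iff[symmetric])
qed

text \<open>
  Dirichlet's theorem provides some \<open>k < q (s + 1)\<close> with \<open>\<parallel>k \<alpha>\<parallel>\<close> small, and \<open>q s\<close> is the best
  among these \<open>k\<close>.
\<close>

lemma nint_dist_best_denom_less:
  assumes q: "is_best_denoms \<alpha> q"
  shows "nint_dist (real (q s) * \<alpha>) < 2 / real (q (Suc s))"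
proof -
  have "q s < q (Suc s)" and "q 0 \<le> q s"
    using q strict_mono_less_eq[of q 0 s] by (simp_all add: is_best_denoms_def strict_mono_less)
  then have q2: "q (Suc s) \<ge> 2"
    using q by (simp add: is_best_denoms_def)
  \<comment> \<open>Dirichlet's theorem bounds \<open>k\<close> by \<open>k \<le> N\<close>, and \<open>k = q (s + 1)\<close> has to be excluded. Taking
    \<open>N = q (s + 1) - 1\<close> for this reason costs the factor 2 in the claim.\<close>
  obtain h k where k: "0 < k" "k \<le> int (q (Suc s) - 1)"
      "\<bar>of_int k * \<alpha> - of_int h\<bar> < 1 / real (q (Suc s) - 1)"
    by (rule Dirichlet_approx[of "q (Suc s) - 1" \<alpha>]) (use q2 in auto)
  have "nint_dist (real (q s) * \<alpha>) \<le> nint_dist (real (nat k) * \<alpha>)"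
  proof (cases "nat k = q s")
    case False
    moreover have "1 \<le> nat k" and "nat k < q (s + 1)"
      using k(1,2) q2 by auto
    ultimately show ?thesis
      using q unfolding is_best_denoms_def by (meson less_imp_le)
  qed simp
  also have "\<dots> \<le> \<bar>of_int k * \<alpha> - of_int h\<bar>"
    using nint_dist_le[of "real (nat k) * \<alpha>" h] k(1) by simp
  also note k(3)
  also have "1 / real (q (Suc s) - 1) \<le> 2 / real (q (Suc s))"
    using q2 by (simp add: field_simps)
  finally show ?thesis .
qed

lemma measurable_nint_dist [measurable]: "nint_dist \<in> borel_measurable borel"
  unfolding nint_dist_def[abs_def] round_def by measurable

lemma borel_measurable_nint_dist_mult [measurable]:
  "(\<lambda>\<alpha>. nint_dist (c * \<alpha>)) \<in> borel_measurable circle_measure"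
  unfolding circle_measure_def
  by (intro measurable_restrict_space1 measurable_completion) simp

text \<open>
  Such \<open>\<alpha>\<close> lie within \<open>\<epsilon> / n\<close> of one of the \<open>n + 1 \<le> 2 n\<close> fractions \<open>m / n\<close> with
  \<open>0 \<le> m \<le> n\<close>. The sharp bound is \<open>2 \<epsilon>\<close>; a factor 2 is lost by counting the neighbourhoods
  of 0 and 1 in full.
\<close>

lemma emeasure_nint_dist_le:
  assumes n: "n \<ge> 1" and \<epsilon>: "\<epsilon> \<ge> 0"
  shows "emeasure circle_measure {\<alpha> \<in> space circle_measure. nint_dist (real n * \<alpha>) \<le> \<epsilon>}
    \<le> ennreal (4 * \<epsilon>)" (is "emeasure _ ?A \<le> _")
proof -
  define I where "I m = {(real m - \<epsilon>) / real n .. (real m + \<epsilon>) / real n}" for m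
  have cover: "?A \<subseteq> (\<Union>m\<le>n. I m)"
  proof
    fix \<alpha> assume "\<alpha> \<in> ?A"
    then have \<alpha>: "0 \<le> \<alpha>" "\<alpha> < 1" and close: "\<bar>real n * \<alpha> - of_int (round (real n * \<alpha>))\<bar> \<le> \<epsilon>"
      by (auto simp: circle_measure_def nint_dist_def)
    define m where "m = nat (round (real n * \<alpha>))"
    have "round (0::real) \<le> round (real n * \<alpha>)"
      using \<alpha> by (intro round_mono) simp
    moreover have "round (real n * \<alpha>) \<le> round (real n)"
      using \<alpha> by (intro round_mono) (simp add: mult_left_le)
    ultimately have "m \<le> n" and "real m = of_int (round (real n * \<alpha>))"
      by (auto simp: m_def)
    with close have "\<alpha> \<in> I m"
      using n by (auto simp: I_def field_simps abs_le_iff)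
    with \<open>m \<le> n\<close> show "\<alpha> \<in> (\<Union>m\<le>n. I m)" by blast
  qed
  have "emeasure circle_measure ?A = emeasure lebesgue ?A"
    unfolding circle_measure_def by (intro emeasure_restrict_space) auto
  also have "\<dots> \<le> emeasure lebesgue (\<Union>m\<le>n. I m)"
    by (intro emeasure_mono cover) (auto simp: I_def)
  also have "\<dots> \<le> (\<Sum>m\<le>n. emeasure lebesgue (I m))"
    by (intro emeasure_subadditive_finite) (auto simp: I_def)
  also have "\<dots> = (\<Sum>m\<le>n. ennreal (2 * \<epsilon> / real n))"
  proof (intro sum.cong refl)
    fix m
    have "(real m - \<epsilon>) / real n \<le> (real m + \<epsilon>) / real n"
      using \<epsilon> by (intro divide_right_mono) auto
    then show "emeasure lebesgue (I m) = ennreal (2 * \<epsilon> / real n)"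
      by (simp add: I_def diff_divide_distrib[symmetric])
  qed
  also have "\<dots> = ennreal (real (Suc n) * (2 * \<epsilon> / real n))"
    by (simp add: ennreal_mult[symmetric] \<epsilon> ennreal_of_nat_eq_real_of_nat del: of_nat_Suc)
  also have "\<dots> \<le> ennreal (4 * \<epsilon>)"
  proof (rule ennreal_leI)
    have "\<epsilon> * 1 \<le> \<epsilon> * real n"
      using n \<epsilon> by (intro mult_left_mono) auto
    then show "real (Suc n) * (2 * \<epsilon> / real n) \<le> 4 * \<epsilon>"
      using n by (simp add: field_simps)
  qed
  finally show ?thesis .
qed

text \<open>
  This is a weighted form of the first Borel--Cantelli lemma: the integral of the sum over \<open>n \<ge> 1\<close>
  is at most \<open>4 \<Sum> c n * \<epsilon> n\<close>, hence finite. With \<open>c = 1\<close> it says that almost every \<open>\<alpha>\<close>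
  satisfies only finitely many of the inequalities.
\<close>

lemma AE_summable_weight_nint_dist_le:
  fixes c \<epsilon> :: "nat \<Rightarrow> real"
  assumes c: "\<And>n. c n \<ge> 0" and \<epsilon>: "\<And>n. \<epsilon> n \<ge> 0"
    and sum: "summable (\<lambda>n. c n * \<epsilon> n)"
  shows "AE \<alpha> in circle_measure.
    summable (\<lambda>n. c n * indicator {\<alpha>. nint_dist (real n * \<alpha>) \<le> \<epsilon> n} \<alpha>)"
proof -
  \<comment> \<open>The term of index 0 is left out: there the inequality holds for every \<open>\<alpha>\<close>, however small
    \<open>\<epsilon> 0\<close> is.\<close>
  define f where "f n \<alpha> = c (Suc n) * indicator {\<alpha>. nint_dist (real (Suc n) * \<alpha>) \<le> \<epsilon> (Suc n)} \<alpha>"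
    for n :: nat and \<alpha> :: real
  have f_nonneg: "f n \<alpha> \<ge> 0" for n \<alpha>
    using c by (simp add: f_def)
  have [measurable]: "f n \<in> borel_measurable circle_measure" for n
    unfolding f_def[abs_def] indicator_def mem_Collect_eq by measurable
  have integral_le: "(\<integral>\<^sup>+\<alpha>. ennreal (f n \<alpha>) \<partial>circle_measure) \<le> ennreal (4 * (c (Suc n) * \<epsilon> (Suc n)))" for n
  proof -
    let ?A = "{\<alpha> \<in> space circle_measure. nint_dist (real (Suc n) * \<alpha>) \<le> \<epsilon> (Suc n)}"
    have A: "?A \<in> sets circle_measure" by measurable
    have "(\<integral>\<^sup>+\<alpha>. ennreal (f n \<alpha>) \<partial>circle_measure)
        = (\<integral>\<^sup>+\<alpha>. ennreal (c (Suc n)) * indicator ?A \<alpha> \<partial>circle_measure)"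
      by (intro nn_integral_cong) (auto simp: f_def indicator_def)
    also have "\<dots> = ennreal (c (Suc n)) * emeasure circle_measure ?A"
      using A by (rule nn_integral_cmult_indicator)
    also have "\<dots> \<le> ennreal (c (Suc n)) * ennreal (4 * \<epsilon> (Suc n))"
      by (intro mult_left_mono emeasure_nint_dist_le \<epsilon>) auto
    also have "\<dots> = ennreal (4 * (c (Suc n) * \<epsilon> (Suc n)))"
      using c \<epsilon> by (simp add: ennreal_mult[symmetric] mult_ac)
    finally show ?thesis .
  qed
  have sum': "summable (\<lambda>n. 4 * (c (Suc n) * \<epsilon> (Suc n)))"
    using sum by (intro summable_mult) (simp only: summable_Suc_iff[of "\<lambda>n. c n * \<epsilon> n"])
  have "(\<integral>\<^sup>+\<alpha>. (\<Sum>n. ennreal (f n \<alpha>)) \<partial>circle_measure)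
      = (\<Sum>n. \<integral>\<^sup>+\<alpha>. ennreal (f n \<alpha>) \<partial>circle_measure)"
    by (intro nn_integral_suminf) measurable
  also have "\<dots> \<le> (\<Sum>n. ennreal (4 * (c (Suc n) * \<epsilon> (Suc n))))"
    by (intro suminf_le integral_le) auto
  also have "\<dots> < \<infinity>"
    by (subst suminf_ennreal_eq[OF _ summable_sums[OF sum']]) (use c \<epsilon> in auto)
  finally have "AE \<alpha> in circle_measure. (\<Sum>n. ennreal (f n \<alpha>)) \<noteq> \<infinity>"
    by (intro nn_integral_PInf_AE) auto
  then show ?thesis
  proof eventually_elim
    case (elim \<alpha>)
    then have "summable (\<lambda>n. f n \<alpha>)"
      using summable_suminf_not_top[of "\<lambda>n. f n \<alpha>"] f_nonneg by simp
    then show ?case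
      unfolding f_def by (subst summable_Suc_iff[symmetric])
  qed
qed

text \<open>
  Completeness turns a property that holds almost everywhere into a measurable set of full measure.
\<close>

lemma complete_measure_circle_measure: "complete_measure circle_measure"
proof
  fix A B :: "real set"
  assume "B \<subseteq> A" "A \<in> null_sets circle_measure"
  then have "B \<subseteq> {0..<1}" "B \<in> null_sets lebesgue"
    by (auto simp: circle_measure_def null_sets_restrict_space intro: null_sets_completion_subset)
  then show "B \<in> sets circle_measure"
    by (auto simp: circle_measure_def sets_restrict_space_iff)
qed

lemma AE_circle_measure_irrational: "AE \<alpha> in circle_measure. \<alpha> \<notin> \<rat>"
proof -
  have "AE \<alpha> in lebesgue. \<alpha> \<notin> (\<rat> :: real set)"
    by (intro AE_completion AE_not_in countable_imp_null_set_lborel countable_rat)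
  then show ?thesis
    unfolding circle_measure_def by (subst AE_restrict_space_iff) auto
qed

text \<open>
  After the injective substitution \<open>n = q i\<close>, the series over \<open>i \<notin> K_set \<alpha>\<close> is part of the
  assumed one: outside \<open>K_set \<alpha>\<close> the large gap to the next denominator puts \<open>q i\<close> among the
  \<open>n\<close> with indicator 1.
\<close>

lemma E_setI:
  fixes \<alpha> :: real
  defines "L \<equiv> \<lambda>n. ln (real n) powr (7/8)"
  assumes \<alpha>: "\<alpha> \<in> {0..<1}" "\<alpha> \<notin> \<rat>"
    and sum: "summable (\<lambda>n. 1 / L n *
      indicator {\<alpha>. nint_dist (real n * \<alpha>) \<le> 2 / (real n * L n)} \<alpha>)"
  shows "\<alpha> \<in> E_set"
proof -
  define q where "q = best_denoms \<alpha>"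
  define g where "g n = 1 / L n *
      indicator {\<alpha>. nint_dist (real n * \<alpha>) \<le> 2 / (real n * L n)} \<alpha>" for n
  let ?I = "{i. i \<notin> K_set \<alpha> \<and> i \<ge> 1}"
  have best: "is_best_denoms \<alpha> q"
    unfolding q_def best_denoms_def by (rule theI'[OF ex1_best_denoms[OF \<alpha>(2)]])
  then have mono: "strict_mono q" and q0: "q 0 = 1"
    by (auto simp: is_best_denoms_def)
  have "g n \<ge> 0" for n
    by (simp add: g_def L_def)
  moreover have "summable g"
    unfolding g_def by (rule sum)
  ultimately have "g summable_on UNIV"
    by (intro norm_summable_imp_summable_on) simp
  then have "g summable_on q ` ?I"
    by (rule summable_on_subset_banach) simp
  then have "(g \<circ> q) summable_on ?I"
    using strict_mono_imp_inj_on[OF mono]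
    by (subst summable_on_reindex[symmetric]) (auto intro: inj_on_subset)
  also have "(g \<circ> q) summable_on ?I \<longleftrightarrow> (\<lambda>i. 1 / L (q i)) summable_on ?I"
  proof (rule summable_on_cong)
    fix i assume i: "i \<in> ?I"
    \<comment> \<open>This is where \<open>i \<ge> 1\<close> enters: \<open>q 0 = 1\<close> would give \<open>L (q 0) = 0\<close>.\<close>
    have "q i > 1"
      using strict_monoD[OF mono, of 0 i] i q0 by simp
    then have L_pos: "L (q i) > 0"
      by (simp add: L_def)
    have "nint_dist (real (q i) * \<alpha>) \<le> 2 / real (q (Suc i))"
      using nint_dist_best_denom_less[OF best] by (rule less_imp_le)
    also have "\<dots> \<le> 2 / (real (q i) * L (q i))"
    proof (rule divide_left_mono)
      show gap: "real (q i) * L (q i) \<le> real (q (Suc i))"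
        using i by (simp add: K_set_def L_def q_def not_less)
      show "0 < real (q (Suc i)) * (real (q i) * L (q i))"
        using gap L_pos \<open>q i > 1\<close> by (intro mult_pos_pos less_le_trans[OF _ gap]) auto
    qed simp
    finally show "(g \<circ> q) i = 1 / L (q i)"
      by (simp add: g_def)
  qed
  finally show ?thesis
    using \<alpha> by (simp add: E_set_def L_def q_def)
qed

theorem proposition1p7:
  shows "measure circle_measure E_set = 1"
proof -
  define L where "L n = ln (real n) powr (7/8)" for n :: nat
  have "summable (\<lambda>n. 2 * (1 / (real n * ln (real n) powr (7/4))))"
    by (intro summable_mult summable_inverse_mult_ln_powr) simp
  moreover have "2 * (1 / (real n * ln (real n) powr (7/4))) = 1 / L n * (2 / (real n * L n))" for n
    using powr_add[of "ln (real n)" "7/8" "7/8"] by (simp add: L_def)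
  ultimately have "summable (\<lambda>n. 1 / L n * (2 / (real n * L n)))"
    by (simp only:)
  then have "AE \<alpha> in circle_measure. summable (\<lambda>n. 1 / L n *
      indicator {\<alpha>. nint_dist (real n * \<alpha>) \<le> 2 / (real n * L n)} \<alpha>)"
    by (intro AE_summable_weight_nint_dist_le) (auto simp: L_def)
  with AE_circle_measure_irrational AE_space
  have AE: "AE \<alpha> in circle_measure. \<alpha> \<in> E_set"
  proof eventually_elim
    case (elim \<alpha>)
    then show ?case
      by (intro E_setI) (simp_all add: L_def circle_measure_def)
  qed
  have sub: "E_set \<subseteq> space circle_measure"
    by (auto simp: E_set_def circle_measure_def)
  interpret complete_measure circle_measure
    by (rule complete_measure_circle_measure)
  have "{\<alpha> \<in> space circle_measure. \<alpha> \<notin> E_set} \<in> null_sets circle_measure"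
    using AE by (simp add: AE_iff_null_sets)
  moreover have "E_set = space circle_measure - {\<alpha> \<in> space circle_measure. \<alpha> \<notin> E_set}"
    using sub by blast
  ultimately have "measure circle_measure E_set = measure circle_measure (space circle_measure)"
    by (metis measure_Diff_null_set sets.top)
  also have "\<dots> = 1"
    by (simp add: measure_def emeasure_circle_measure_space)
  finally show ?thesis .
qed

end
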